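(* Assume that $1\le s\le t$ and $\mathcal{F}\subset\binom{[n]}{k}$ is an $(s,t)$-union-intersecting set system. Then $$|\mathcal{F}|\le\binom{n-1}{k-1}+s-1$$ holds for all $n>n(k,t)$, where $n(k,t)$ is a threshold depending only on $k$ and $t$.
   Context: $[n]=\{1,2,\dots,n\}$, and $\binom{[n]}{k}$ denotes the set of all $k$-element subsets of $[n]$. Here $s,t,k,n$ are integers. A set system is a family of distinct sets. A set system $\mathcal{F}$ is called $(s,t)$-union-intersecting if for all $s+t$ pairwise different sets $F_1,\dots,F_s,G_1,\dots,G_t\in\mathcal{F}$, $$\left(\bigcup_{i=1}^s F_i\right)\cap\left(\bigcup_{j=1}^t G_j\right)\ne\emptyset.$$
   Formalization: Assumes k ≥ 1, and k ≥ 2 unless t = 1: for k = 1, t ≥ 2 the claim fails for {{1},…,{s+t−1}}, which is vacuously (s,t)-union-intersecting with s+t−1 > s members; for k = 0, s = 1 it fails for {∅}. *)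

theory Defs
  imports Main "HOL-Library.FuncSet" "HOL-Library.Ramsey"
begin

definition union_intersecting :: "nat \<Rightarrow> nat \<Rightarrow> 'a set set \<Rightarrow> bool" where
  "union_intersecting s t \<F> \<longleftrightarrow>
    (\<forall>F G. F \<in> {1..s} \<rightarrow> \<F> \<and> G \<in> {1..t} \<rightarrow> \<F> \<and>
           inj_on F {1..s} \<and> inj_on G {1..t} \<and> F ` {1..s} \<inter> G ` {1..t} = {} \<longrightarrow>
           (\<Union>i\<in>{1..s}. F i) \<inter> (\<Union>j\<in>{1..t}. G j) \<noteq> {})"

end

theory Submission
  imports Defs
begin

text \<open>
  Call two sets of the family adjacent if they are disjoint; the family is
  \<open>(s,t)\<close>-union-intersecting iff this graph contains no \<open>K\<^sub>s\<^sub>,\<^sub>t\<close>. If all points had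
  degree at most \<open>D\<close>, then \<open>s\<close> arbitrary members would be met by at most \<open>s k D\<close> others, so
  \<open>card \<F> < s + t + s k D\<close>; hence a family of size about \<open>n ^ (k - 1)\<close> has a point \<open>x\<close> whose
  degree is of the order \<open>n ^ (k - 1)\<close>. If \<open>s\<close> members avoided \<open>x\<close>, they would meet only
  \<open>O(n ^ (k - 2))\<close> of the members through \<open>x\<close>, leaving \<open>t\<close> members disjoint from all of them.
  So at most \<open>s - 1\<close> members avoid \<open>x\<close>.
\<close>

text \<open>Enumerating \<open>A\<close> and \<open>B\<close> turns the indexed form of the
  definition into one about sets, which suits counting.\<close>

lemma union_intersectingD:
  assumes "union_intersecting s t \<F>" "A \<subseteq> \<F>" "B \<subseteq> \<F>" "A \<inter> B = {}"
    and "finite A" "finite B" "card A = s" "card B = t"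
  shows "\<Union>A \<inter> \<Union>B \<noteq> {}"
proof -
  obtain f where f: "bij_betw f {1..s} A"
    using ex_bij_betw_nat_finite_1[OF \<open>finite A\<close>] \<open>card A = s\<close> by blast
  obtain g where g: "bij_betw g {1..t} B"
    using ex_bij_betw_nat_finite_1[OF \<open>finite B\<close>] \<open>card B = t\<close> by blast
  have im: "f ` {1..s} = A" "g ` {1..t} = B"
    using f g by (simp_all add: bij_betw_def)
  have "f \<in> {1..s} \<rightarrow> \<F>" "g \<in> {1..t} \<rightarrow> \<F>"
    using im assms(2,3) by auto
  moreover have "inj_on f {1..s}" "inj_on g {1..t}"
    using f g by (simp_all add: bij_betw_def)
  moreover have "f ` {1..s} \<inter> g ` {1..t} = {}"
    using assms(4) im by simp
  ultimately have "(\<Union>i\<in>{1..s}. f i) \<inter> (\<Union>j\<in>{1..t}. g j) \<noteq> {}"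
    using assms(1)[unfolded union_intersecting_def, rule_format, of f g] by blast
  then show ?thesis
    using im by simp
qed

text \<open>Fewer than \<open>t\<close> members of \<open>B\<close> miss \<open>\<Union>A\<close>,
  since \<open>t\<close> of them would contradict \<open>ui\<close>. Every other member of
  \<open>B\<close> contains one of the at most \<open>s * k\<close> points of
  \<open>\<Union>A\<close>, and each point accounts for at most \<open>D\<close> of them.\<close>

lemma union_intersecting_card_less:
  assumes ui: "union_intersecting s t \<F>" and "A \<subseteq> \<F>" "B \<subseteq> \<F>" "A \<inter> B = {}"
    and fin: "finite A" "finite B" and "card A = s"
    and k: "\<And>X. X \<in> A \<Longrightarrow> finite X \<and> card X \<le> k"
    and D: "\<And>y. y \<in> \<Union>A \<Longrightarrow> card {G \<in> B. y \<in> G} \<le> D"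
  shows "card B < t + s * k * D"
proof -
  define C where "C = {G \<in> B. G \<inter> \<Union>A = {}}"
  have "card C < t"
  proof (rule ccontr)
    assume "\<not> card C < t"
    then obtain C' where C': "C' \<subseteq> C" "card C' = t" "finite C'"
      by (metis not_less obtain_subset_with_card_n)
    then have "\<Union>A \<inter> \<Union>C' \<noteq> {}"
      using assms by (intro union_intersectingD[OF ui]) (auto simp: C_def)
    then show False
      using C'(1) by (auto simp: C_def)
  qed
  moreover have "card (B - C) \<le> s * k * D"
  proof -
    have "card (\<Union>A) \<le> (\<Sum>X\<in>A. card X)"
      by (rule card_Union_le_sum_card)
    also have "\<dots> \<le> s * k"
      using sum_bounded_above[of A card k] k \<open>card A = s\<close> by simp
    finally have U: "card (\<Union>A) \<le> s * k" .
    have finU: "finite (\<Union>A)"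
      using fin k by auto
    have "card (B - C) \<le> card (\<Union>y\<in>\<Union>A. {G \<in> B. y \<in> G})"
      using finU fin(2) by (intro card_mono finite_UN_I) (auto simp: C_def)
    also have "\<dots> \<le> (\<Sum>y\<in>\<Union>A. card {G \<in> B. y \<in> G})"
      by (rule card_UN_le[OF finU])
    also have "\<dots> \<le> card (\<Union>A) * D"
      using sum_bounded_above[of "\<Union>A" "\<lambda>y. card {G \<in> B. y \<in> G}" D] D by simp
    also have "\<dots> \<le> s * k * D"
      using U by simp
    finally show ?thesis .
  qed
  moreover have "card B = card C + card (B - C)"
    using fin(2) by (subst card_Diff_subset) (auto simp: C_def card_mono)
  ultimately show ?thesis
    by linarith
qed

lemma card_nsets_containing_le:
  assumes "finite V" "S \<subseteq> V" "\<F> \<subseteq> nsets V k"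
  shows "card {G \<in> \<F>. S \<subseteq> G} \<le> (card V - card S) choose (k - card S)"
proof -
  have "finite S"
    using assms finite_subset by blast
  have "card {G \<in> \<F>. S \<subseteq> G} \<le> card (nsets (V - S) (k - card S))"
  proof (rule card_inj_on_le)
    show "inj_on (\<lambda>G. G - S) {G \<in> \<F>. S \<subseteq> G}"
      by (auto simp: inj_on_def)
    show "(\<lambda>G. G - S) ` {G \<in> \<F>. S \<subseteq> G} \<subseteq> nsets (V - S) (k - card S)"
      using assms(3) \<open>finite S\<close> by (auto simp: nsets_def card_Diff_subset)
    show "finite (nsets (V - S) (k - card S))"
      using assms(1) by (simp add: finite_imp_finite_nsets)
  qed
  then show ?thesis
    using assms \<open>finite S\<close> by (simp add: card_Diff_subset)
qed

text \<open>The threshold is chosen to contradict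
  \<open>(?n - 1 choose (k - 1)) \<le> (t + t * k * (t + t * k)) * c\<close>, which results from
  combining two applications of the counting lemma: one bounds the family by the maximum degree
  \<open>D\<close>, the other bounds \<open>D\<close> by pair degrees.\<close>

lemma card_union_intersecting_le:
  fixes \<F> :: "'a set set"
  assumes "2 \<le> k" "s \<le> t" and n: "card V > k + k * (t + t * k * (t + t * k))"
    and "finite V" and sub: "\<F> \<subseteq> nsets V k" and ui: "union_intersecting s t \<F>"
  shows "card \<F> < (card V - 1 choose (k - 1)) + s"
proof (rule ccontr)
  let ?n = "card V" and ?deg = "\<lambda>x. card {G \<in> \<F>. x \<in> G}"
  assume "\<not> ?thesis"
  then have large: "(?n - 1 choose (k - 1)) + s \<le> card \<F>"
    by simp
  have fin: "finite \<F>"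
    using sub \<open>finite V\<close> by (meson finite_imp_finite_nsets finite_subset)
  have members: "finite X \<and> card X \<le> k" "X \<subseteq> V" if "X \<in> \<F>" for X
    using that sub by (auto simp: nsets_def)
  \<comment> \<open>Bounds the number of members through two given points. Being positive,
    \<open>c\<close> can absorb additive constants and be cancelled at the end.\<close>
  define c where "c = (?n - 2 choose (k - 2))"
  have "c > 0"
    unfolding c_def using n by (intro zero_less_binomial) linarith
  then have "c \<ge> 1"
    by linarith
  have "V \<noteq> {}"
    using n by auto
  define D where "D = Max (?deg ` V)"
  have "D \<in> ?deg ` V"
    using \<open>V \<noteq> {}\<close> \<open>finite V\<close> by (auto simp: D_def intro: Max_in)
  then obtain x where x: "x \<in> V" "?deg x = D"
    by auto
  have deg: "?deg y \<le> D" if "y \<in> V" for y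
    using that \<open>finite V\<close> by (simp add: D_def)
  obtain A where A: "A \<subseteq> \<F>" "card A = s" "finite A"
    using large by (metis add_leD2 obtain_subset_with_card_n)
  have "card (\<F> - A) < t + s * k * D"
  proof (rule union_intersecting_card_less[OF ui A(1) _ _ A(3) _ A(2)])
    fix y assume "y \<in> \<Union>A"
    then have "?deg y \<le> D"
      using A members deg by blast
    moreover have "card {G \<in> \<F> - A. y \<in> G} \<le> ?deg y"
      using fin by (intro card_mono) auto
    ultimately show "card {G \<in> \<F> - A. y \<in> G} \<le> D"
      by simp
  qed (use A members fin in auto)
  moreover have "card (\<F> - A) = card \<F> - s"
    using A by (simp add: card_Diff_subset)
  moreover have "s * k * D \<le> t * k * D"
    using \<open>s \<le> t\<close> by simp
  \<comment> \<open>The \<open>s\<close> sets removed with \<open>A\<close> cancel the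
    \<open>+ s\<close> in \<open>large\<close>.\<close>
  ultimately have upper: "(?n - 1 choose (k - 1)) \<le> t + t * k * D"
    using large by linarith
  \<comment> \<open>At most \<open>?n - 1 choose (k - 1)\<close> members contain \<open>x\<close>,
    so the assumed excess \<open>s\<close> must avoid it.\<close>
  have "s \<le> card {G \<in> \<F>. x \<notin> G}"
  proof -
    have "D \<le> (?n - 1 choose (k - 1))"
      using card_nsets_containing_le[OF \<open>finite V\<close> _ sub, of "{x}"] x by simp
    moreover have "card \<F> = D + card {G \<in> \<F>. x \<notin> G}"
    proof -
      have "card ({G \<in> \<F>. x \<in> G} \<union> {G \<in> \<F>. x \<notin> G}) = D + card {G \<in> \<F>. x \<notin> G}"
        using fin x by (subst card_Un_disjoint) auto
      moreover have "{G \<in> \<F>. x \<in> G} \<union> {G \<in> \<F>. x \<notin> G} = \<F>"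
        by auto
      ultimately show ?thesis
        by simp
    qed
    ultimately show ?thesis
      using large by linarith
  qed
  then obtain A' where A': "A' \<subseteq> {G \<in> \<F>. x \<notin> G}" "card A' = s" "finite A'"
    by (meson obtain_subset_with_card_n)
  \<comment> \<open>Points of \<open>\<Union>A'\<close> differ from \<open>x\<close>, so among the
    members through \<open>x\<close> their degree is a pair degree, at most
    \<open>c\<close>.\<close>
  have "card {G \<in> \<F>. x \<in> G} < t + s * k * c"
  proof (rule union_intersecting_card_less[OF ui _ _ _ A'(3) _ A'(2)])
    fix y assume "y \<in> \<Union>A'"
    then have y: "y \<in> V" "y \<noteq> x"
      using A' members by blast+
    have "{G \<in> {G \<in> \<F>. x \<in> G}. y \<in> G} = {G \<in> \<F>. {x, y} \<subseteq> G}"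
      by auto
    moreover have "card {x, y} = 2" "{x, y} \<subseteq> V"
      using x y by auto
    ultimately show "card {G \<in> {G \<in> \<F>. x \<in> G}. y \<in> G} \<le> c"
      using card_nsets_containing_le[OF \<open>finite V\<close> _ sub, of "{x, y}"]
      by (simp only: c_def)
  qed (use A' members fin in auto)
  moreover have "s * k * c \<le> t * k * c"
    using \<open>s \<le> t\<close> by simp
  ultimately have "D \<le> t + t * k * c"
    using x by linarith
  also have "\<dots> \<le> (t + t * k) * c"
    using \<open>c \<ge> 1\<close> by (simp add: add_mult_distrib)
  finally have "t * k * D \<le> t * k * (t + t * k) * c"
    by (simp only: mult.assoc mult_le_mono2)
  moreover have "t \<le> t * c"
    using \<open>c \<ge> 1\<close> by simp
  ultimately have "(?n - 1 choose (k - 1)) \<le> (t + t * k * (t + t * k)) * c"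
    using upper unfolding add_mult_distrib[of t "t * k * (t + t * k)" c] by linarith
  then have "(k - 1) * (?n - 1 choose (k - 1)) \<le> (k - 1) * (t + t * k * (t + t * k)) * c"
    by (simp only: mult.assoc mult_le_mono2)
  \<comment> \<open>By absorption the binomial is \<open>c\<close> times
    \<open>(?n - 1) / (k - 1)\<close>, a factor that grows with \<open>?n\<close>.\<close>
  moreover have "(k - 1) * (?n - 1 choose (k - 1)) = (?n - 1) * c"
  proof -
    have "Suc (k - 2) = k - 1" "?n - 1 - 1 = ?n - 2"
      using \<open>2 \<le> k\<close> by simp_all
    then show ?thesis
      using binomial_absorption[of "k - 2" "?n - 1"] by (simp only: c_def)
  qed
  ultimately have "(?n - 1) * c \<le> (k - 1) * (t + t * k * (t + t * k)) * c"
    by (simp only:)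
  then have "?n - 1 \<le> (k - 1) * (t + t * k * (t + t * k))"
    using \<open>c > 0\<close> by (simp only: mult_le_cancel2)
  also have "\<dots> \<le> k * (t + t * k * (t + t * k))"
    by (rule mult_le_mono1) simp
  finally show False
    using n \<open>2 \<le> k\<close> by linarith
qed

lemma card_union_intersecting_singletons_le:
  assumes ui: "union_intersecting 1 1 \<F>" and sub: "\<F> \<subseteq> nsets V 1" and "finite V"
  shows "card \<F> \<le> 1"
proof (cases "\<F> = {}")
  case False
  then obtain X where X: "X \<in> \<F>"
    by blast
  have fin: "finite \<F>"
    using sub \<open>finite V\<close> by (meson finite_imp_finite_nsets finite_subset)
  have singleton: "\<exists>a. Y = {a}" if "Y \<in> \<F>" for Y
    using that sub by (auto simp: nsets_def card_1_singleton_iff)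
  \<comment> \<open>Distinct singletons are disjoint, so the degree bound here is
    \<open>0\<close>.\<close>
  have "card (\<F> - {X}) < 1 + 1 * 1 * 0"
  proof (rule union_intersecting_card_less[OF ui, of "{X}"])
    fix y assume "y \<in> \<Union>{X}"
    then have "Y = X" if "Y \<in> \<F>" "y \<in> Y" for Y
      using singleton[OF X] singleton[OF that(1)] that(2) by auto
    then have "{G \<in> \<F> - {X}. y \<in> G} = {}"
      by blast
    then show "card {G \<in> \<F> - {X}. y \<in> G} \<le> 0"
      by (simp only: card.empty)
  qed (use X fin singleton[OF X] in auto)
  then show ?thesis
    using X fin by simp
qed simp

text \<open>For \<open>k = 1\<close> and \<open>t \<ge> 2\<close> the bound fails: any
  \<open>s + t - 1\<close> singletons satisfy the condition vacuously, while the bound is only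
  \<open>s\<close>. Hence the second assumption.\<close>

theorem theorem4p1:
  fixes k t :: nat
  assumes "1 \<le> k" and "2 \<le> k \<or> t = 1"
  shows "\<exists>N::nat. \<forall>n>N. \<forall>(s::nat) (\<F>::nat set set).
           1 \<le> s \<longrightarrow> s \<le> t \<longrightarrow> \<F> \<subseteq> nsets {1..n} k \<longrightarrow> union_intersecting s t \<F> \<longrightarrow>
           card \<F> \<le> ((n - 1) choose (k - 1)) + s - 1"
proof (intro exI allI impI)
  fix n s :: nat and \<F> :: "nat set set"
  assume n: "n > k + k * (t + t * k * (t + t * k))" and s: "1 \<le> s" "s \<le> t"
    and sub: "\<F> \<subseteq> nsets {1..n} k" and ui: "union_intersecting s t \<F>"
  show "card \<F> \<le> ((n - 1) choose (k - 1)) + s - 1"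
  proof (cases "2 \<le> k")
    case True
    then show ?thesis
      using card_union_intersecting_le[of k s t "{1..n}" \<F>] n s sub ui by simp
  next
    case False
    then have "k = 1" "t = 1" "s = 1"
      using assms s by auto
    then show ?thesis
      using card_union_intersecting_singletons_le[of \<F> "{1..n}"] sub ui by simp
  qed
qed

end
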